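(* Let $(X,p,E)$ be a lattice-normed Riesz space, let $(x_n)$ be a sequence in $X$ and let $x\in X$. If $(x_n)$ is statistically unbounded $p$-convergent to $x$, and $(x_n)$ is decreasing with $x_n\ge 0$ for all $n$, then every subsequence $(x_{k_n})_{n\in\mathbb{N}}$ whose index set $\{k_1<k_2<\cdots\}$ satisfies $\delta(\{k_1,k_2,\dots\})=1$ is statistically unbounded $p$-convergent to $x$.
   Context: All Riesz spaces (vector lattices) are real and Archimedean; sequences are indexed by the positive integers $\mathbb{N}$; $E_+$ and $X_+$ denote positive cones. A lattice-normed Riesz space $(X,p,E)$ consists of Riesz spaces $X$ and $E$ and a map $p:X\to E_+$ with $p(x)=0\Leftrightarrow x=0$, $p(\lambda x)=|\lambda|p(x)$ for $\lambda\in\mathbb{R}$, $p(x+y)\le p(x)+p(y)$, which is monotone: $|x|\le|y|$ implies $p(x)\le p(y)$. The natural density of $K\subseteq\mathbb{N}$ is $\delta(K)=\lim_{n}\frac1n|\{k\le n:k\in K\}|$. A sequence $(q_n)$ in $E$ is statistically order decreasing to $0$, written $q_n\downarrow^{st}0$, if there is $K\subseteq\mathbb{N}$ with $\delta(K)=1$ such that $(q_k)_{k\in K}$ is decreasing and $\inf_{k\in K}q_k=0$. A sequence $(x_n)$ in $X$ is statistically unbounded $p$-convergent ($st$-$up$-convergent) to $x\in X$ if for every $u\in X_+$ there exist a sequence $q_n\downarrow^{st}0$ in $E$ and a set $K\subseteq\mathbb{N}$ with $\delta(K)=1$ such that $p(|x_k-x|\wedge u)\le q_k$ for all $k\in K$.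 *)

theory Defs
  imports Complex_Main "HOL-Library.Lattice_Algebras" "HOL-Library.Lub_Glb"
begin

text \<open>
  Real Archimedean vector lattices. The modulus is pinned down to
  \<open>\<bar>a\<bar> = sup a (- a)\<close> by the class \<^class>\<open>lattice_ab_group_add_abs\<close>.
\<close>

class archimedean_riesz_space = ordered_real_vector + lattice_ab_group_add_abs +
  assumes archimedean: "0 \<le> a \<Longrightarrow> (\<And>n::nat. real n *\<^sub>R a \<le> b) \<Longrightarrow> a = 0"

text \<open>The class is inhabited:\<close>

instance real :: archimedean_riesz_space
proof
  show "a = 0" if "0 \<le> a" "\<And>n::nat. real n *\<^sub>R a \<le> b" for a b :: real
  proof (rule ccontr)
    assume "a \<noteq> 0"
    with \<open>0 \<le> a\<close> have "0 < a" by simp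
    then obtain n :: nat where "b < real n * a"
      using reals_Archimedean3 by blast
    with that(2)[of n] show False by simp
  qed
qed

locale lattice_normed_riesz_space =
  fixes p :: "'a::archimedean_riesz_space \<Rightarrow> 'b::archimedean_riesz_space"
  assumes p_nonneg: "0 \<le> p x"
    and p_eq_0_iff: "p x = 0 \<longleftrightarrow> x = 0"
    and p_scaleR: "p (c *\<^sub>R x) = \<bar>c\<bar> *\<^sub>R p x"
    and p_triangle: "p (x + y) \<le> p x + p y"
    and p_mono: "\<bar>x\<bar> \<le> \<bar>y\<bar> \<Longrightarrow> p x \<le> p y"

text \<open>
  Sequences are indexed by the positive integers: they are functions on \<^typ>\<open>nat\<close> of which
  only the values on \<open>{1..}\<close> matter, and index sets are subsets of \<open>{1..}\<close>.
\<close>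

definition has_natural_density :: "nat set \<Rightarrow> real \<Rightarrow> bool" where
  "has_natural_density K d \<longleftrightarrow>
     (\<lambda>n. real (card {k \<in> {1..n}. k \<in> K}) / real n) \<longlonglongrightarrow> d"

definition st_order_decreasing_0 :: "(nat \<Rightarrow> 'b::archimedean_riesz_space) \<Rightarrow> bool" where
  "st_order_decreasing_0 q \<longleftrightarrow>
     (\<exists>K\<subseteq>{1..}. has_natural_density K 1 \<and> antimono_on K q \<and> isGlb UNIV (q ` K) 0)"

definition st_up_convergent ::
  "('a::archimedean_riesz_space \<Rightarrow> 'b::archimedean_riesz_space) \<Rightarrow> (nat \<Rightarrow> 'a) \<Rightarrow> 'a \<Rightarrow> bool" where
  "st_up_convergent p xs x \<longleftrightarrow>
     (\<forall>u\<ge>0. \<exists>q K. st_order_decreasing_0 q \<and> K \<subseteq> {1..} \<and> has_natural_density K 1 \<and>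
        (\<forall>k\<in>K. p (inf \<bar>xs k - x\<bar> u) \<le> q k))"

end

theory Submission
  imports Defs
begin

text \<open>
  Counting up to \<open>k\<^sub>N\<close> shows that the preimage of a set of density 1 under an index sequence with
  range of density 1 again has density 1. Hence the dominating sequence \<open>q\<close> can be replaced by
  \<open>q \<circ> k\<close>: on a cofinal subset of its index set a decreasing sequence keeps its infimum.
\<close>

text \<open>Inclusion-exclusion inside \<open>{1..n}\<close> leaves at least |A| + |B| - n common
  elements. So the proportion of \<open>A \<inter> B\<close> is squeezed between that of
  \<open>B\<close> and the sum of both proportions minus 1, and each bound tends to
  \<open>d\<close>.\<close>

lemma has_natural_density_Int:
  assumes "has_natural_density A 1" "has_natural_density B d"
  shows "has_natural_density (A \<inter> B) d"
proof -
  let ?c = "\<lambda>K n. real (card {k \<in> {1..n}. k \<in> K}) / real n"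
  have A: "?c A \<longlonglongrightarrow> 1" and B: "?c B \<longlonglongrightarrow> d"
    using assms by (auto simp: has_natural_density_def)
  have "(\<lambda>n. ?c A n + ?c B n - 1) \<longlonglongrightarrow> 1 + d - 1"
    by (intro tendsto_intros A B)
  then have lower: "(\<lambda>n. ?c A n + ?c B n - 1) \<longlonglongrightarrow> d" by simp
  have "?c A n + ?c B n - 1 \<le> ?c (A \<inter> B) n" if "n \<ge> 1" for n
  proof -
    let ?A = "{k \<in> {1..n}. k \<in> A}" and ?B = "{k \<in> {1..n}. k \<in> B}"
    have "card ?A + card ?B = card (?A \<union> ?B) + card (?A \<inter> ?B)"
      by (intro card_Un_Int) auto
    moreover have "card (?A \<union> ?B) \<le> card {1..n}" by (intro card_mono) auto
    moreover have "?A \<inter> ?B = {k \<in> {1..n}. k \<in> A \<inter> B}" by auto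
    ultimately have "real (card ?A) + real (card ?B) - real n
        \<le> real (card {k \<in> {1..n}. k \<in> A \<inter> B})" by simp
    then have "(real (card ?A) + real (card ?B) - real n) / real n
        \<le> real (card {k \<in> {1..n}. k \<in> A \<inter> B}) / real n" by (intro divide_right_mono) auto
    with that show ?thesis by (simp add: add_divide_distrib diff_divide_distrib)
  qed
  then have ev_lower: "\<forall>\<^sub>F n in sequentially. ?c A n + ?c B n - 1 \<le> ?c (A \<inter> B) n"
    using eventually_sequentially by blast
  have ev_upper: "\<forall>\<^sub>F n in sequentially. ?c (A \<inter> B) n \<le> ?c B n"
    by (intro always_eventually allI divide_right_mono of_nat_mono card_mono) auto
  show ?thesis
    unfolding has_natural_density_def by (rule tendsto_sandwich[OF ev_lower ev_upper lower B])
qed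

lemma has_natural_density_infinite:
  assumes "has_natural_density K d" "d \<noteq> 0"
  shows "infinite K"
proof
  assume "finite K"
  have "(\<lambda>n. real (card {k \<in> {1..n}. k \<in> K}) / real n) \<longlonglongrightarrow> 0"
  proof (rule tendsto_sandwich[where f = "\<lambda>_. 0"])
    show "\<forall>\<^sub>F n in sequentially. real (card {k \<in> {1..n}. k \<in> K}) / real n \<le> real (card K) / real n"
      using \<open>finite K\<close>
      by (intro always_eventually allI divide_right_mono of_nat_mono card_mono) auto
    show "(\<lambda>n. real (card K) / real n) \<longlonglongrightarrow> 0" by (rule lim_const_over_n)
  qed auto
  with assms show False
    unfolding has_natural_density_def using LIMSEQ_unique by blast
qed

lemma strict_mono_on_ge_self:
  fixes k :: "nat \<Rightarrow> nat"
  assumes "strict_mono_on {1..} k" "k ` {1..} \<subseteq> {1..}" "n \<ge> 1"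
  shows "n \<le> k n"
  using \<open>n \<ge> 1\<close>
proof (induction n rule: dec_induct)
  case base
  show ?case using assms(2) by auto
next
  case (step n)
  have "k n < k (Suc n)" using step.hyps by (intro strict_mono_onD[OF assms(1)]) auto
  with step.IH show ?case by simp
qed

text \<open>Write R for the range of \<open>k\<close> and J for the preimage of \<open>K\<close>.
  Since \<open>k\<close> maps J bijectively onto \<open>R \<inter> K\<close>, the proportion of J up
  to \<open>n\<close> is the proportion of \<open>R \<inter> K\<close> up to \<open>k n\<close>
  divided by that of R. These two tend to \<open>d\<close> and 1.\<close>

lemma has_natural_density_vimage:
  fixes k :: "nat \<Rightarrow> nat"
  assumes mono: "strict_mono_on {1..} k" and pos: "k ` {1..} \<subseteq> {1..}"
    and range: "has_natural_density (k ` {1..}) 1" and K: "has_natural_density K d"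
  shows "has_natural_density {n \<in> {1..}. k n \<in> K} d"
proof -
  let ?c = "\<lambda>K n. real (card {k \<in> {1..n}. k \<in> K}) / real n"
  let ?R = "k ` {1..}"
  let ?J = "{n \<in> {1..}. k n \<in> K}"
  \<comment> \<open>Lets the density limits be evaluated along the counting bounds
    \<open>k n\<close>.\<close>
  have lim_k: "filterlim k at_top sequentially"
  proof (rule filterlim_at_top_mono[OF filterlim_ident])
    show "\<forall>\<^sub>F n in sequentially. n \<le> k n"
      using strict_mono_on_ge_self[OF mono pos] eventually_sequentially by blast
  qed
  have inj: "inj_on k {1..}" by (rule strict_mono_on_imp_inj_on[OF mono])
  \<comment> \<open>As \<open>k\<close> preserves and reflects order, the values of \<open>k\<close>
    not exceeding \<open>k n\<close> are those at indices up to \<open>n\<close>.\<close>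
  have count: "card {i \<in> {1..k n}. i \<in> k ` S} = card {i \<in> {1..n}. i \<in> S}"
    if "n \<ge> 1" "S \<subseteq> {1..}" for n S
  proof -
    have "{i \<in> {1..k n}. i \<in> k ` S} = k ` {i \<in> {1..n}. i \<in> S}"
      using that pos by (auto simp: strict_mono_on_leD[OF mono] subset_iff
          strict_mono_on_less_eq[OF mono])
    moreover have "inj_on k {i \<in> {1..n}. i \<in> S}" by (rule inj_on_subset[OF inj]) auto
    ultimately show ?thesis by (simp add: card_image)
  qed
  have KR: "k ` ?J = ?R \<inter> K" by auto
  have "(\<lambda>n. ?c (?R \<inter> K) (k n) / ?c ?R (k n)) \<longlonglongrightarrow> d / 1"
    using has_natural_density_Int[OF range K] range
    by (intro tendsto_divide filterlim_compose[OF _ lim_k]) (auto simp: has_natural_density_def)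
  \<comment> \<open>The common divisor \<open>k n\<close> is nonzero and cancels; exactly
    \<open>n\<close> elements of the range remain in the denominator.\<close>
  moreover have "?c (?R \<inter> K) (k n) / ?c ?R (k n) = ?c ?J n" if "n \<ge> 1" for n
  proof -
    have "card {i \<in> {1..k n}. i \<in> ?R \<inter> K} = card {i \<in> {1..n}. i \<in> ?J}"
      using count[OF that, of ?J] unfolding KR by auto
    moreover have "card {i \<in> {1..k n}. i \<in> ?R} = n"
    proof -
      have "{i \<in> {1..n}. i \<in> {1..}} = {1..n}" by auto
      then show ?thesis using count[OF that, of "{1..}"] by simp
    qed
    moreover have "k n \<noteq> 0" using pos that by fastforce
    ultimately show ?thesis by simp
  qed
  then have "\<forall>\<^sub>F n in sequentially. ?c (?R \<inter> K) (k n) / ?c ?R (k n) = ?c ?J n"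
    using eventually_sequentially by blast
  ultimately show ?thesis
    unfolding has_natural_density_def by (simp add: tendsto_cong)
qed

text \<open>An infinite set of naturals is unbounded, so beyond each \<open>i \<in> K\<close> lies
  some \<open>j \<in> L\<close> with \<open>q j \<le> q i\<close>. Thus \<open>q\<close> has the
  same lower bounds on \<open>L\<close> as on \<open>K\<close>.\<close>

lemma isGlb_antimono_on_infinite_subset:
  fixes q :: "nat \<Rightarrow> 'b::order"
  assumes "antimono_on K q" "isGlb UNIV (q ` K) a" "L \<subseteq> K" "infinite L"
  shows "isGlb UNIV (q ` L) a"
proof -
  have glb: "a \<le> q i" "(\<And>j. j \<in> K \<Longrightarrow> b \<le> q j) \<Longrightarrow> b \<le> a" if "i \<in> K" for i b
    using assms(2) that
    by (auto simp: isGlb_def isLb_def greatestP_def setle_def setge_def)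
  have lb: "b \<le> q i" if b: "\<And>j. j \<in> L \<Longrightarrow> b \<le> q j" and i: "i \<in> K" for b i
  proof -
    obtain j where j: "j \<in> L" "i \<le> j"
      using \<open>infinite L\<close> finite_nat_set_iff_bounded_le by (meson nat_le_linear)
    have "b \<le> q j" using b j(1) .
    also have "q j \<le> q i" using j i assms(3) by (intro monotone_onD[OF assms(1)]) auto
    finally show ?thesis .
  qed
  \<comment> \<open>The second part of \<open>glb\<close> is stated relative to an element of
    \<open>K\<close>, which is supplied here.\<close>
  have "L \<noteq> {}" using \<open>infinite L\<close> by auto
  then obtain i where "i \<in> L" by blast
  then have "i \<in> K" using assms(3) by auto
  have "b \<le> a" if "\<And>j. j \<in> L \<Longrightarrow> b \<le> q j" for b
    using glb(2)[OF \<open>i \<in> K\<close>] lb[OF that] .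
  moreover have "a \<le> q j" if "j \<in> L" for j
    using glb(1) that assms(3) by auto
  ultimately show ?thesis
    by (simp add: isGlb_def isLb_def greatestP_def setle_def setge_def)
qed

lemma st_order_decreasing_0_subseq:
  fixes q :: "nat \<Rightarrow> 'b::archimedean_riesz_space" and k :: "nat \<Rightarrow> nat"
  assumes "st_order_decreasing_0 q"
    and mono: "strict_mono_on {1..} k" and pos: "k ` {1..} \<subseteq> {1..}"
    and range: "has_natural_density (k ` {1..}) 1"
  shows "st_order_decreasing_0 (\<lambda>n. q (k n))"
proof -
  obtain K where K: "has_natural_density K 1" "antimono_on K q" "isGlb UNIV (q ` K) 0"
    using assms(1) unfolding st_order_decreasing_0_def by blast
  let ?J = "{n \<in> {1..}. k n \<in> K}"
  have J: "has_natural_density ?J 1" by (rule has_natural_density_vimage[OF mono pos range K(1)])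
  have inj: "inj_on k ?J"
    by (rule inj_on_subset[OF strict_mono_on_imp_inj_on[OF mono]]) auto
  \<comment> \<open>Density 1 makes the preimage infinite, and injectivity of \<open>k\<close>
    carries this over to its image, a cofinal subset of \<open>K\<close> on which the infimum is
    still 0.\<close>
  have "infinite ?J" using J by (rule has_natural_density_infinite) simp
  then have inf: "infinite (k ` ?J)" using finite_image_iff[OF inj] by simp
  have "antimono_on ?J (\<lambda>n. q (k n))"
    by (intro monotone_onI monotone_onD[OF K(2)] strict_mono_on_leD[OF mono]) auto
  moreover have "isGlb UNIV (q ` k ` ?J) 0"
    by (rule isGlb_antimono_on_infinite_subset[OF K(2,3) _ inf]) auto
  then have "isGlb UNIV ((\<lambda>n. q (k n)) ` ?J) 0" by (simp add: image_image)
  ultimately show ?thesis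
    unfolding st_order_decreasing_0_def using J by (intro exI[of _ ?J]) auto
qed

theorem theorem4p2:
  fixes p :: "'a::archimedean_riesz_space \<Rightarrow> 'b::archimedean_riesz_space"
    and xs :: "nat \<Rightarrow> 'a" and x :: 'a and k :: "nat \<Rightarrow> nat"
  assumes "lattice_normed_riesz_space p"
    and "st_up_convergent p xs x"
    and "antimono_on {1..} xs"
    and "\<And>n. n \<ge> 1 \<Longrightarrow> xs n \<ge> 0"
    and "strict_mono_on {1..} k"
    and "k ` {1..} \<subseteq> {1..}"
    and "has_natural_density (k ` {1..}) 1"
  shows "st_up_convergent p (\<lambda>n. xs (k n)) x"
  unfolding st_up_convergent_def
proof (intro allI impI)
  fix u :: 'a
  assume "0 \<le> u"
  then obtain q K where q: "st_order_decreasing_0 q" and K: "has_natural_density K 1"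
    and le: "\<And>i. i \<in> K \<Longrightarrow> p (inf \<bar>xs i - x\<bar> u) \<le> q i"
    using assms(2) unfolding st_up_convergent_def by meson
  \<comment> \<open>The bound \<open>le\<close> applies at index \<open>k n\<close> whenever
    \<open>k n \<in> K\<close>, so this preimage is the index set on which \<open>q\<close> composed
    with \<open>k\<close> dominates the subsequence.\<close>
  have "has_natural_density {n \<in> {1..}. k n \<in> K} 1"
    by (rule has_natural_density_vimage[OF assms(5-7) K])
  with st_order_decreasing_0_subseq[OF q assms(5-7)] le
  show "\<exists>q K. st_order_decreasing_0 q \<and> K \<subseteq> {1..} \<and> has_natural_density K 1 \<and>
      (\<forall>i\<in>K. p (inf \<bar>xs (k i) - x\<bar> u) \<le> q i)"
    by (intro exI[of _ "\<lambda>n. q (k n)"] exI[of _ "{n \<in> {1..}. k n \<in> K}"]) auto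
qed

end
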